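(* Let $0<\lambda\le1$. If $f\in\mathcal{G}(\lambda)$, then there exists an integer $n\ge1$ such that $f'(z)\prec (1+z^n)^{\lambda/n}$ in $\mathbb{D}$, and $$g(z)=z\exp\left(\int_0^z\frac{f'(t)-1}{t}\,\mathrm{d}t\right)\in\mathcal{ST}_{ss}(\lambda/n).$$
   Context: $\mathbb{D}=\{z\in\mathbb{C}:|z|<1\}$. $\mathcal{A}$ is the class of holomorphic functions in $\mathbb{D}$ of the form $f(z)=z+\sum_{n\ge 2}a_nz^n$. For $0<\lambda\le 1$, $\mathcal{G}(\lambda)$ is the class of locally univalent functions $f\in\mathcal{A}$ (i.e. $f'\neq 0$ in $\mathbb{D}$) such that $\Re\left(1+zf''(z)/f'(z)\right)<1+\lambda/2$ for all $z\in\mathbb{D}$. The symbol $\prec$ denotes subordination: $p\prec q$ in $\mathbb{D}$ if $p=q\circ\omega$ for some analytic $\omega:\mathbb{D}\to\mathbb{D}$ with $\omega(0)=0$. $\mathcal{ST}$ is the class of univalent $f\in\mathcal{A}$ with $\Re\{zf'(z)/f(z)\}>0$ in $\mathbb{D}$ (starlike functions). For $0<\lambda\le1$, $\mathcal{ST}_{ss}(\lambda)$ is the subfamily of $f\in\mathcal{ST}$ satisfying $zf'(z)/f(z)\prec(1+z)^\lambda$ in $\mathbb{D}$. All powers use the branch equal to $1$ at $z=0$. *)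

theory Defs
  imports "HOL-Complex_Analysis.Complex_Analysis"
begin

abbreviation unit_disc :: "complex set" where
  "unit_disc \<equiv> ball 0 1"

definition class_A :: "(complex \<Rightarrow> complex) set" where
  "class_A = {f. f holomorphic_on unit_disc \<and>
     (\<exists>a :: nat \<Rightarrow> complex. a 0 = 0 \<and> a 1 = 1 \<and>
        (\<forall>z\<in>unit_disc. (\<lambda>n. a n * z ^ n) sums f z))}"

definition class_G :: "real \<Rightarrow> (complex \<Rightarrow> complex) set" where
  "class_G lam = {f \<in> class_A.
     (\<forall>z\<in>unit_disc. deriv f z \<noteq> 0) \<and>
     (\<forall>z\<in>unit_disc. Re (1 + z * deriv (deriv f) z / deriv f z) < 1 + lam / 2)}"

definition subordinate :: "(complex \<Rightarrow> complex) \<Rightarrow> (complex \<Rightarrow> complex) \<Rightarrow> bool"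
    (infix "\<prec>\<^sub>s" 50) where
  "p \<prec>\<^sub>s q \<longleftrightarrow> (\<exists>w. w holomorphic_on unit_disc \<and> w ` unit_disc \<subseteq> unit_disc \<and> w 0 = 0 \<and>
     (\<forall>z\<in>unit_disc. p z = q (w z)))"

(* For f in class_A the quotient z f'(z) / f(z) has a removable singularity at 0 with value 1;
   division by zero in HOL would give 0 there. *)
definition starlike_quotient :: "(complex \<Rightarrow> complex) \<Rightarrow> complex \<Rightarrow> complex" where
  "starlike_quotient f z = (if z = 0 then 1 else z * deriv f z / f z)"

definition class_ST :: "(complex \<Rightarrow> complex) set" where
  "class_ST = {f \<in> class_A. inj_on f unit_disc \<and>
     (\<forall>z\<in>unit_disc. Re (starlike_quotient f z) > 0)}"

(* 1 + z lies in the right half-plane for z in the disc, so the principal power is holomorphic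
   there and is the branch equal to 1 at z = 0. *)
definition class_ST_ss :: "real \<Rightarrow> (complex \<Rightarrow> complex) set" where
  "class_ST_ss lam = {f \<in> class_ST. starlike_quotient f \<prec>\<^sub>s (\<lambda>z. (1 + z) powr of_real lam)}"

(* The integrand has a removable singularity at t = 0, so its value there is immaterial, and by
   Cauchy's theorem the integral may be taken along the segment. *)
definition log_integral_transform :: "(complex \<Rightarrow> complex) \<Rightarrow> complex \<Rightarrow> complex" where
  "log_integral_transform f z =
     z * exp (contour_integral (linepath 0 z) (\<lambda>t. (deriv f t - 1) / t))"

end

theory Submission
  imports Defs
begin

text \<open>
  The exponent \<open>n = 1\<close> works for every \<open>f\<close> in the class. Write
  \<open>f' = exp (\<lambda> u)\<close> with \<open>u 0 = 0\<close>; the defining condition of \<open>G(\<lambda>)\<close> becomes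
  \<open>Re (z u') < 1/2\<close>. Put \<open>w = exp u - 1\<close>, so that \<open>f' = (1 + w)^\<lambda>\<close>, and suppose that \<open>w\<close> leaves
  the unit disc. At a point \<open>z\<close> of least modulus with \<open>|w z| \<ge> 1\<close>, Jack's lemma gives
  \<open>z w' = k w\<close> with \<open>k \<ge> 1\<close>, hence \<open>z u' = k w / (1 + w)\<close>. Since \<open>w / (1 + w)\<close> has real part at
  least \<open>1/2\<close> outside the open unit disc, this contradicts the bound on \<open>Re (z u')\<close>. Thus \<open>w\<close> is
  a Schwarz function, which proves the subordination of \<open>f'\<close> (lemma \<open>subordinate_one_plus_powr\<close>).

  The transform \<open>g = z exp Q\<close>, where \<open>z Q' = f' - 1\<close>, satisfies \<open>z g' / g = f'\<close>, so the same Schwarz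
  function gives the subordination for \<open>g\<close>; as \<open>\<lambda> \<le> 1\<close>, it also gives \<open>Re f' > 0\<close>. It remains to see
  that \<open>g\<close> is univalent. In the coordinate \<open>z = exp s\<close>, with \<open>s\<close> in the left half-plane, \<open>g\<close>
  lifts to \<open>G s = s + Q (exp s)\<close>, whose derivative \<open>f' (exp s)\<close> has positive real part. The
  half-plane is convex, so \<open>G\<close> is injective by the Noshiro-Warschawski criterion, and
  \<open>G (s + 2 \<pi> i) = G s + 2 \<pi> i\<close> transfers the injectivity to \<open>g\<close> (lemma \<open>inj_on_times_exp\<close>).
\<close>

section \<open>Jack's lemma\<close>

lemma has_real_derivative_Re_compose:
  assumes "(f has_field_derivative D) (at (p t))" and "(p has_vector_derivative p') (at t)"
  shows "((\<lambda>s. Re (f (p s))) has_real_derivative Re (p' * D)) (at t)"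
  using has_field_derivative_Re[OF field_vector_diff_chain_at[OF assms(2,1)]]
  by (simp add: o_def)

text \<open>
  The normalised form of Jack's lemma at the boundary point \<open>1\<close>. On the unit circle \<open>Re v\<close> has a
  maximum at \<open>1\<close>, so its tangential derivative vanishes there; this makes \<open>v' 1\<close> real. By the
  Schwarz lemma \<open>Re (v t) \<le> t\<close> for \<open>0 < t < 1\<close>, with equality at \<open>t = 1\<close>; this bounds the radial
  derivative from below.
\<close>

lemma Jack_boundary:
  assumes holo: "v holomorphic_on ball 0 r" and r: "1 < r"
    and v0: "v 0 = 0" and v1: "v 1 = 1"
    and lt: "\<And>z. norm z < 1 \<Longrightarrow> norm (v z) < 1"
  shows "Im (deriv v 1) = 0" and "1 \<le> Re (deriv v 1)"
proof -
  have D: "(v has_field_derivative deriv v 1) (at 1)"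
    using holo r by (intro holomorphic_derivI[of v "ball 0 r"]) auto
  have "v holomorphic_on ball 0 1"
    using holo by (rule holomorphic_on_subset) (use r in auto)
  then have schwarz: "norm (v z) \<le> norm z" if "norm z < 1" for z
    using v0 lt that by (rule Schwarz_Lemma(1))
  have circ: "norm (v z) \<le> 1" if "norm z = 1" for z
  proof (rule continuous_on_closure_norm_le[where s = "ball 0 1" and f = v])
    have "cball (0::complex) 1 \<subseteq> ball 0 r"
      using r by auto
    then show "continuous_on (closure (ball 0 1)) v"
      using continuous_on_subset[OF holomorphic_on_imp_continuous_on[OF holo]] by simp
  qed (use lt that in \<open>auto intro: less_imp_le\<close>)
  have "((\<lambda>t. Re (v (cis t))) has_real_derivative Re (\<i> * deriv v 1)) (at 0)"
  proof (rule has_real_derivative_Re_compose[where p = cis])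
    show "(v has_field_derivative deriv v 1) (at (cis 0))"
      using D by simp
    show "(cis has_vector_derivative \<i>) (at 0)"
      by (auto intro!: derivative_eq_intros simp: has_vector_derivative_complex_iff)
  qed
  then have "Re (\<i> * deriv v 1) = 0"
  proof (rule DERIV_local_max[where d = 1])
    have "Re (v (cis t)) \<le> 1" for t
      using circ[of "cis t"] complex_Re_le_cmod[of "v (cis t)"] by simp
    then show "\<forall>t. \<bar>0 - t\<bar> < 1 \<longrightarrow> Re (v (cis t)) \<le> Re (v (cis 0))"
      by (simp add: v1)
  qed simp
  then show "Im (deriv v 1) = 0"
    by simp
  have "((\<lambda>t. Re (v (complex_of_real t))) has_real_derivative Re (1 * deriv v 1)) (at 1)"
  proof (rule has_real_derivative_Re_compose[where p = complex_of_real])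
    show "(v has_field_derivative deriv v 1) (at (complex_of_real 1))"
      using D by simp
    show "(complex_of_real has_vector_derivative 1) (at 1)"
      by (auto intro!: derivative_eq_intros simp: has_vector_derivative_complex_iff)
  qed
  then have rad: "((\<lambda>t. Re (v (complex_of_real t)) - t) has_real_derivative Re (deriv v 1) - 1) (at 1)"
    using DERIV_diff[OF _ DERIV_ident] by fastforce
  show "1 \<le> Re (deriv v 1)"
  proof (rule ccontr)
    assume "\<not> 1 \<le> Re (deriv v 1)"
    then obtain d where "0 < d"
      and d: "\<And>h. 0 < h \<Longrightarrow> h < d \<Longrightarrow>
        Re (v (complex_of_real 1)) - 1 < Re (v (complex_of_real (1 - h))) - (1 - h)"
      using DERIV_neg_dec_left[OF rad] by auto
    define h where "h = min d 1 / 2"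
    have h: "0 < h" "h < d" "h < 1"
      using \<open>0 < d\<close> by (auto simp: h_def)
    have "Re (v (complex_of_real (1 - h))) \<le> norm (complex_of_real (1 - h))"
      using schwarz[of "complex_of_real (1 - h)"] h
        complex_Re_le_cmod[of "v (complex_of_real (1 - h))"]
      by (simp only: norm_of_real) linarith
    also have "\<dots> = 1 - h"
      using h by (simp only: norm_of_real)
    finally show False
      using d[OF h(1,2)] v1 by simp
  qed
qed

text \<open>
  Rescaling to \<open>v z = w (z0 z) / w z0\<close> moves \<open>z0\<close> to the boundary point \<open>1\<close>, and
  \<open>v' 1 = z0 w' z0 / w z0\<close>.
\<close>

lemma Jack:
  assumes holo: "w holomorphic_on ball 0 R" and w0: "w 0 = 0"
    and z0: "z0 \<in> ball 0 R" "z0 \<noteq> 0"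
    and lt: "\<And>z. norm z < norm z0 \<Longrightarrow> norm (w z) < norm (w z0)"
  obtains k :: real where "1 \<le> k" and "z0 * deriv w z0 = of_real k * w z0"
proof
  define v where "v = (\<lambda>z. w (z0 * z) / w z0)"
  have wz0: "w z0 \<noteq> 0"
    using lt[of 0] z0 by auto
  have R: "norm z0 < R"
    using z0 by simp
  have maps: "(\<lambda>z. z0 * z) ` ball 0 (R / norm z0) \<subseteq> ball 0 R"
    using z0 by (auto simp: norm_mult field_simps)
  have "(w \<circ> (\<lambda>z. z0 * z)) holomorphic_on ball 0 (R / norm z0)"
    by (intro holomorphic_on_compose_gen[OF _ holo maps] holomorphic_intros)
  then have v: "v holomorphic_on ball 0 (R / norm z0)"
    unfolding v_def o_def using wz0 by (intro holomorphic_intros)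
  have "(w has_field_derivative deriv w z0) (at (z0 * 1))"
    using holomorphic_derivI[OF holo _ z0(1)] by simp
  then have "((\<lambda>z. w (z0 * z)) has_field_derivative deriv w z0 * z0) (at 1)"
    by (rule DERIV_chain2) (auto intro!: derivative_eq_intros)
  then have "(v has_field_derivative deriv w z0 * z0 / w z0) (at 1)"
    unfolding v_def by (rule DERIV_cdivide)
  then have dv: "deriv v 1 = z0 * deriv w z0 / w z0"
    by (simp add: DERIV_imp_deriv mult.commute)
  have "norm (v z) < 1" if "norm z < 1" for z
    using lt[of "z0 * z"] that z0 wz0 by (auto simp: v_def norm_mult norm_divide)
  then have "Im (deriv v 1) = 0" and ge: "1 \<le> Re (deriv v 1)"
    using Jack_boundary[OF v] R z0 w0 wz0 by (auto simp: v_def)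
  then have "deriv v 1 = of_real (Re (deriv v 1))"
    by (simp add: complex_eq_iff)
  then show "z0 * deriv w z0 = of_real (Re (deriv v 1)) * w z0"
    using wz0 unfolding dv by (metis nonzero_eq_divide_eq)
  show "1 \<le> Re (deriv v 1)"
    by (rule ge)
qed

section \<open>Subordination to a power of the half-plane map\<close>

lemma half_le_Re_div_one_plus:
  assumes "1 \<le> norm w" and "1 + w \<noteq> 0"
  shows "1 / 2 \<le> Re (w / (1 + w))"
proof -
  have n: "0 < (1 + Re w)\<^sup>2 + (Im w)\<^sup>2"
    using assms(2) by (auto simp: complex_eq_iff sum_power2_gt_zero_iff)
  have "1 \<le> (norm w)\<^sup>2"
    using assms(1) by simp
  then have "1 \<le> (Re w)\<^sup>2 + (Im w)\<^sup>2"
    by (simp add: cmod_power2)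
  then show ?thesis
    using n by (simp add: Re_divide field_simps power2_eq_square)
qed

text \<open>
  The sharp constant \<open>1/2\<close> is the bound of \<open>Re (w / (1 + w))\<close> on the unit disc, and \<open>z u'\<close> is a
  multiple of \<open>w / (1 + w)\<close> wherever Jack's lemma applies to \<open>w = exp u - 1\<close>.
\<close>

lemma norm_exp_minus_one_less:
  assumes holo: "u holomorphic_on ball 0 1" and u0: "u 0 = 0"
    and Re: "\<And>z. norm z < 1 \<Longrightarrow> Re (z * deriv u z) < 1 / 2"
    and z: "norm z < 1"
  shows "norm (exp (u z) - 1) < 1"
proof (rule ccontr)
  define w where "w = (\<lambda>z. exp (u z) - 1)"
  assume "\<not> norm (exp (u z) - 1) < 1"
  then have wz: "1 \<le> norm (w z)"
    by (simp add: w_def)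
  have w: "w holomorphic_on ball 0 1"
    unfolding w_def by (intro holomorphic_intros holo)
  \<comment> \<open>Jack's lemma needs a point of least modulus in this compact set.\<close>
  define K where "K = {y \<in> cball 0 (norm z). 1 \<le> norm (w y)}"
  have "continuous_on (cball 0 (norm z)) (\<lambda>y. norm (w y))"
    using w z by (intro continuous_intros)
      (auto intro!: continuous_on_subset[OF holomorphic_on_imp_continuous_on])
  then have "closed (cball 0 (norm z) \<inter> (\<lambda>y. norm (w y)) -` {1..})"
    by (rule continuous_closed_preimage) auto
  moreover have "K = cball 0 (norm z) \<inter> (\<lambda>y. norm (w y)) -` {1..}"
    by (auto simp: K_def)
  moreover have "bounded K"
    by (rule bounded_subset[OF bounded_cball[of 0 "norm z"]]) (auto simp: K_def)
  ultimately have "compact K"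
    by (simp add: compact_eq_bounded_closed)
  moreover have "z \<in> K"
    using wz by (simp add: K_def)
  ultimately obtain z0 where z0: "z0 \<in> K" and min: "\<And>y. y \<in> K \<Longrightarrow> norm z0 \<le> norm y"
    using continuous_attains_inf[of K norm] by (auto intro: continuous_intros)
  have z0_le: "norm z0 \<le> norm z" and wz0: "1 \<le> norm (w z0)"
    using z0 by (auto simp: K_def)
  have lt: "norm (w y) < norm (w z0)" if "norm y < norm z0" for y
  proof -
    have "norm (w y) < 1"
      using min[of y] that z0_le by (force simp: K_def)
    then show ?thesis
      using wz0 by simp
  qed
  have w0: "w 0 = 0"
    by (simp add: w_def u0)
  then have "z0 \<noteq> 0"
    using wz0 by auto
  have z0_ball: "z0 \<in> ball 0 1"
    using z0_le z by simp
  obtain k :: real where k: "1 \<le> k" "z0 * deriv w z0 = of_real k * w z0"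
    using Jack[OF w w0 z0_ball \<open>z0 \<noteq> 0\<close> lt] by blast
  have "(w has_field_derivative exp (u z0) * deriv u z0) (at z0)"
    unfolding w_def using holomorphic_derivI[OF holo _ z0_ball]
    by (auto intro!: derivative_eq_intros)
  then have "deriv w z0 = (1 + w z0) * deriv u z0"
    by (simp add: DERIV_imp_deriv w_def)
  moreover have nz: "1 + w z0 \<noteq> 0"
    by (simp add: w_def)
  ultimately have "z0 * deriv u z0 = of_real k * (w z0 / (1 + w z0))"
    using k(2) by (simp add: field_simps)
  then have "Re (z0 * deriv u z0) = k * Re (w z0 / (1 + w z0))"
    by (simp only: Re_complex_of_real Im_complex_of_real times_complex.sel)
  moreover have "1 / 2 \<le> Re (w z0 / (1 + w z0))"
    using half_le_Re_div_one_plus[OF wz0 nz] .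
  moreover have "Re (w z0 / (1 + w z0)) \<le> k * Re (w z0 / (1 + w z0))"
    using mult_right_mono[OF k(1), of "Re (w z0 / (1 + w z0))"] calculation(2) by simp
  moreover have "Re (z0 * deriv u z0) < 1 / 2"
    using Re[of z0] z0_ball by simp
  ultimately show False
    by linarith
qed

lemma Re_pos_of_near_one:
  assumes "norm (y - 1) < 1"
  shows "0 < Re y"
  using abs_Re_le_cmod[of "y - 1"] assms by simp

text \<open>
  Both sides are holomorphic logarithms of \<open>exp (u z)\<close>, which stays in the right half-plane, so
  their difference is a constant, and it vanishes at the origin. This identifies \<open>exp (\<lambda> u)\<close> with
  the principal power of \<open>exp u\<close>.
\<close>

lemma Ln_exp_of_near_one:
  assumes holo: "u holomorphic_on ball 0 1" and u0: "u 0 = 0"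
    and near: "\<And>z. norm z < 1 \<Longrightarrow> norm (exp (u z) - 1) < 1"
    and z: "norm z < 1"
  shows "Ln (exp (u z)) = u z"
proof -
  have "\<exists>c. \<forall>y\<in>ball 0 1. Ln (exp (u y)) - u y = c"
  proof (rule has_field_derivative_zero_constant)
    fix y :: complex
    assume y: "y \<in> ball 0 1"
    have "exp (u y) \<notin> \<real>\<^sub>\<le>\<^sub>0"
      using Re_pos_of_near_one[OF near, of y] y by (auto simp: complex_nonpos_Reals_iff)
    then have "((\<lambda>y. Ln (exp (u y)) - u y) has_field_derivative 0) (at y)"
      using holomorphic_derivI[OF holo _ y] by (auto intro!: derivative_eq_intros)
    then show "((\<lambda>y. Ln (exp (u y)) - u y) has_field_derivative 0) (at y within ball 0 1)"
      by (rule has_field_derivative_at_within)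
  qed simp
  then obtain c where c: "\<And>y. norm y < 1 \<Longrightarrow> Ln (exp (u y)) - u y = c"
    by auto
  from c[of 0] c[OF z] u0 show ?thesis
    by simp
qed

text \<open>
  With \<open>h = exp (\<lambda> u)\<close> one has \<open>z h' / h = \<lambda> z u'\<close>, so the hypothesis on \<open>h\<close> is exactly what makes
  \<open>exp u - 1\<close> a Schwarz function.
\<close>

lemma subordinate_one_plus_powr:
  assumes lam: "0 < lam" and holo: "h holomorphic_on ball 0 1" and h0: "h 0 = 1"
    and nz: "\<And>z. norm z < 1 \<Longrightarrow> h z \<noteq> 0"
    and Re: "\<And>z. norm z < 1 \<Longrightarrow> Re (z * deriv h z / h z) < lam / 2"
  shows "h \<prec>\<^sub>s (\<lambda>z. (1 + z) powr of_real lam)"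
proof -
  obtain L where L: "L holomorphic_on ball 0 1" and hL: "\<And>z. z \<in> ball 0 1 \<Longrightarrow> h z = exp (L z)"
    using contractible_imp_holomorphic_log[OF holo convex_imp_contractible[OF convex_ball]] nz
    by auto
  define u where "u = (\<lambda>z. (L z - L 0) / of_real lam)"
  have u: "u holomorphic_on ball 0 1"
    unfolding u_def using lam by (intro holomorphic_intros L) auto
  have u0: "u 0 = 0"
    by (simp add: u_def)
  have hu: "h z = exp (of_real lam * u z)" if "norm z < 1" for z
    using hL[of z] hL[of 0] that lam h0 by (simp add: u_def exp_diff)
  have u_Re: "Re (z * deriv u z) < 1 / 2" if "norm z < 1" for z
  proof -
    have z: "z \<in> ball 0 1"
      using that by simp
    have "((\<lambda>z. exp (of_real lam * u z)) has_field_derivative h z * (of_real lam * deriv u z)) (at z)"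
      using holomorphic_derivI[OF u _ z] hu[OF that] by (auto intro!: derivative_eq_intros)
    then have "(h has_field_derivative h z * (of_real lam * deriv u z)) (at z)"
      by (rule has_field_derivative_transform_within_open[OF _ open_ball z]) (simp add: hu)
    then have "z * deriv h z / h z = of_real lam * (z * deriv u z)"
      using nz[OF that] by (simp add: DERIV_imp_deriv)
    then have "lam * Re (z * deriv u z) < lam * (1 / 2)"
      using Re[OF that] by simp
    then show ?thesis
      using lam by (rule mult_left_less_imp_less[OF _ less_imp_le])
  qed
  note near = norm_exp_minus_one_less[OF u u0 u_Re]
  show ?thesis
    unfolding subordinate_def
  proof (intro exI conjI ballI)
    show "(\<lambda>z. exp (u z) - 1) holomorphic_on ball 0 1"
      by (intro holomorphic_intros u)
    show "(\<lambda>z. exp (u z) - 1) ` ball 0 1 \<subseteq> ball 0 1"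
      using near by auto
    show "exp (u 0) - 1 = 0"
      by (simp add: u0)
    show "h z = (1 + (exp (u z) - 1)) powr of_real lam" if "z \<in> ball 0 1" for z
      using that hu[of z] Ln_exp_of_near_one[OF u u0 near] by (simp add: powr_def)
  qed
qed

lemma Re_one_plus_powr_pos:
  assumes "0 < lam" and "lam \<le> 1" and "norm z < 1"
  shows "0 < Re ((1 + z) powr of_real lam)"
proof -
  have pos: "0 < Re (1 + z)"
    using Re_pos_of_near_one[of "1 + z"] assms(3) by simp
  then have nz: "1 + z \<noteq> 0"
    by (metis less_irrefl zero_complex.sel(1))
  have arg: "\<bar>Im (Ln (1 + z))\<bar> < pi / 2"
    using Re_Ln_pos_lt_imp[OF pos] .
  have "\<bar>lam * Im (Ln (1 + z))\<bar> \<le> \<bar>Im (Ln (1 + z))\<bar>"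
    using assms by (simp add: abs_mult mult_left_le_one_le)
  then have "0 < cos (lam * Im (Ln (1 + z)))"
    using arg by (intro cos_gt_zero_pi) auto
  then show ?thesis
    using nz by (simp add: powr_def Re_exp)
qed

section \<open>Univalence in the logarithmic coordinate\<close>

text \<open>
  Along the segment from \<open>a\<close> to \<open>b\<close>, the derivative of \<open>Re (G / (b - a))\<close> is \<open>Re G'\<close>, so this
  function increases strictly and \<open>G\<close> cannot take the same value at both ends.
\<close>

lemma Noshiro_Warschawski:
  assumes S: "convex S"
    and D: "\<And>z. z \<in> S \<Longrightarrow> (G has_field_derivative G' z) (at z)"
    and pos: "\<And>z. z \<in> S \<Longrightarrow> 0 < Re (G' z)"
  shows "inj_on G S"
proof (rule inj_onI, rule ccontr)
  fix a b
  assume a: "a \<in> S" and b: "b \<in> S" and eq: "G a = G b" and ne: "a \<noteq> b"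
  define p where "p = (\<lambda>t::real. a + of_real t * (b - a))"
  have "Re (G (p 0) / (b - a)) < Re (G (p 1) / (b - a))"
  proof (rule DERIV_pos_imp_increasing[of 0 1 "\<lambda>t. Re (G (p t) / (b - a))"])
    fix t :: real
    assume t: "0 \<le> t" "t \<le> 1"
    have "p t = (1 - t) *\<^sub>R a + t *\<^sub>R b"
      by (simp add: p_def scaleR_conv_of_real algebra_simps)
    then have "p t \<in> S"
      using convexD_alt[OF S a b t] by simp
    have "((\<lambda>z. G z / (b - a)) has_field_derivative G' (p t) / (b - a)) (at (p t))"
      using D[OF \<open>p t \<in> S\<close>] by (rule DERIV_cdivide)
    moreover have "(p has_vector_derivative b - a) (at t)"
      unfolding p_def by (auto intro!: derivative_eq_intros simp: has_vector_derivative_complex_iff)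
    ultimately have "((\<lambda>t. Re (G (p t) / (b - a))) has_real_derivative
        Re ((b - a) * (G' (p t) / (b - a)))) (at t)"
      by (rule has_real_derivative_Re_compose)
    then show "\<exists>y. ((\<lambda>t. Re (G (p t) / (b - a))) has_real_derivative y) (at t) \<and> 0 < y"
      using pos[OF \<open>p t \<in> S\<close>] ne by auto
  qed simp
  then show False
    using eq by (simp add: p_def)
qed

text \<open>
  For \<open>g z = z exp (Q z)\<close> the hypothesis says \<open>Re (z g' / g) > 0\<close>, so this is the univalence of
  starlike functions. The exponential maps the left half-plane onto the punctured disc and lifts
  \<open>g\<close> to \<open>G s = s + Q (exp s)\<close>, to which the Noshiro-Warschawski criterion applies.
\<close>

lemma inj_on_times_exp:
  assumes holo: "Q holomorphic_on ball 0 1"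
    and pos: "\<And>z. norm z < 1 \<Longrightarrow> 0 < Re (1 + z * deriv Q z)"
  shows "inj_on (\<lambda>z. z * exp (Q z)) (ball 0 1)"
proof (rule inj_onI)
  fix z1 z2 :: complex
  assume z1: "z1 \<in> ball 0 1" and z2: "z2 \<in> ball 0 1"
    and eq: "z1 * exp (Q z1) = z2 * exp (Q z2)"
  define H where "H = {s::complex. Re s < 0}"
  define G where "G = (\<lambda>s. s + Q (exp s))"
  have inj: "inj_on G H"
  proof (rule Noshiro_Warschawski)
    show "convex H"
      unfolding H_def by (rule convex_halfspace_Re_lt)
    fix s
    assume "s \<in> H"
    then have s: "exp s \<in> ball 0 1"
      by (simp add: H_def)
    show "(G has_field_derivative 1 + exp s * deriv Q (exp s)) (at s)"
      unfolding G_def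
      using DERIV_chain2[OF holomorphic_derivI[OF holo open_ball s, where T = UNIV] DERIV_exp]
      by (auto intro!: derivative_eq_intros simp: mult.commute)
    show "0 < Re (1 + exp s * deriv Q (exp s))"
      using pos[of "exp s"] s by simp
  qed
  show "z1 = z2"
  proof (cases "z1 = 0 \<or> z2 = 0")
    case True
    then show ?thesis
      using eq by auto
  next
    case False
    have mem: "Ln z1 \<in> H" "Ln z2 \<in> H"
      using False z1 z2 by (auto simp: H_def Re_Ln)
    have "exp (G (Ln z1)) = exp (G (Ln z2))"
      using eq False by (simp add: G_def exp_add)
    then obtain n :: int where n: "G (Ln z1) = G (Ln z2) + (of_int (2 * n) * pi) * \<i>"
      using exp_eq by blast
    \<comment> \<open>Shifting by a period absorbs the multiple of \<open>2 \<pi> i\<close>, because \<open>G\<close> commutes with the shift.\<close>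
    define s where "s = Ln z2 + (of_int (2 * n) * pi) * \<i>"
    have exp_s: "exp s = z2"
      using exp_eq[of s "Ln z2"] False by (auto simp: s_def)
    have "G s = G (Ln z1)"
      using n exp_s False by (simp add: G_def s_def)
    moreover have "s \<in> H"
      using mem(2) by (simp add: H_def s_def)
    ultimately have "s = Ln z1"
      using inj mem(1) by (auto dest: inj_onD)
    then show ?thesis
      using exp_s False by simp
  qed
qed

section \<open>The integral transform\<close>

text \<open>
  The integrand differs only at the origin from a holomorphic function on the disc, whose primitive
  vanishing at the origin is \<open>Q\<close>.
\<close>

lemma log_integral_transform_as_exp:
  assumes holo: "f holomorphic_on ball 0 1" and d0: "deriv f 0 = 1"
  obtains Q where "Q holomorphic_on ball 0 1" and "Q 0 = 0"
    and "\<And>z. norm z < 1 \<Longrightarrow> log_integral_transform f z = z * exp (Q z)"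
    and "\<And>z. norm z < 1 \<Longrightarrow> z * deriv Q z = deriv f z - 1"
proof -
  define q where "q = (\<lambda>z. if z = 0 then deriv (deriv f) 0 else (deriv f z - deriv f 0) / (z - 0))"
  have "q holomorphic_on ball 0 1"
    unfolding q_def by (intro pole_lemma_open holomorphic_deriv holo) auto
  then obtain P where "\<And>z. z \<in> ball 0 1 \<Longrightarrow> (P has_field_derivative q z) (at z within ball 0 1)"
    using holomorphic_convex_primitive'[OF convex_ball open_ball] by blast
  then have P: "(P has_field_derivative q z) (at z)" if "z \<in> ball 0 1" for z
    using that by (metis at_within_open open_ball)
  define Q where "Q = (\<lambda>z. P z - P 0)"
  have Q: "(Q has_field_derivative q z) (at z)" if "z \<in> ball 0 1" for z
    unfolding Q_def using P[OF that] by (auto intro!: derivative_eq_intros)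
  show thesis
  proof
    show "Q holomorphic_on ball 0 1"
      using Q by (meson holomorphic_on_open open_ball)
    show "Q 0 = 0"
      by (simp add: Q_def)
    fix z :: complex
    assume "norm z < 1"
    then have z: "z \<in> ball 0 1"
      by simp
    show "z * deriv Q z = deriv f z - 1"
      using DERIV_imp_deriv[OF Q[OF z]] d0 by (simp add: q_def)
    show "log_integral_transform f z = z * exp (Q z)"
    proof (cases "z = 0")
      case True
      then show ?thesis
        by (simp add: log_integral_transform_def)
    next
      case False
      have sub: "path_image (linepath 0 z) \<subseteq> ball 0 1"
        using z by (simp add: closed_segment_subset)
      have "(q has_contour_integral (Q (pathfinish (linepath 0 z)) - Q (pathstart (linepath 0 z))))
          (linepath 0 z)"
        by (rule contour_integral_primitive[OF _ valid_path_linepath sub])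
          (rule has_field_derivative_at_within[OF Q])
      then have "contour_integral (linepath 0 z) q = Q z"
        by (simp add: contour_integral_unique Q_def)
      moreover have "contour_integral (linepath 0 z) (\<lambda>t. (deriv f t - 1) / t) =
          contour_integral (linepath 0 z) q"
        using False d0
        by (intro contour_integral_spike_finite_simple_path[of "{0}"]) (auto simp: q_def)
      ultimately show ?thesis
        by (simp add: log_integral_transform_def)
    qed
  qed
qed

lemma class_A_deriv_0:
  assumes "f \<in> class_A"
  shows "deriv f 0 = 1"
proof -
  obtain a :: "nat \<Rightarrow> complex" where a1: "a 1 = 1"
    and sums: "\<And>z. norm z < 1 \<Longrightarrow> (\<lambda>n. a n * z ^ n) sums f z"
    using assms by (auto simp: class_A_def)
  have "((\<lambda>z. \<Sum>n. a n * z ^ n) has_field_derivative (\<Sum>n. diffs a n * 0 ^ n)) (at 0)"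
    using sums by (intro termdiffs_strong'[of 1]) (auto intro: sums_summable)
  then have "((\<lambda>z. \<Sum>n. a n * z ^ n) has_field_derivative 1) (at 0)"
    using a1 by (simp add: powser_zero diffs_def)
  then have "(f has_field_derivative 1) (at 0)"
    by (rule has_field_derivative_transform_within_open[of _ _ _ "ball 0 1"])
      (use sums in \<open>auto simp: sums_iff\<close>)
  then show ?thesis
    by (rule DERIV_imp_deriv)
qed

lemma class_A_I:
  assumes holo: "g holomorphic_on ball 0 1" and "g 0 = 0" and "deriv g 0 = 1"
  shows "g \<in> class_A"
  unfolding class_A_def mem_Collect_eq
proof (intro conjI exI ballI)
  show "(\<lambda>n. (deriv ^^ n) g 0 / fact n * z ^ n) sums g z" if "z \<in> ball 0 1" for z
    using holomorphic_power_series[OF holo that] by simp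
qed (use assms in auto)

lemma subordinate_cong_left:
  assumes "p \<prec>\<^sub>s q" and "\<And>z. norm z < 1 \<Longrightarrow> p' z = p z"
  shows "p' \<prec>\<^sub>s q"
  using assms unfolding subordinate_def by auto

text \<open>
  Logarithmic differentiation of \<open>z exp (Q z)\<close> gives \<open>1 + z Q' = f'\<close>, so positivity of
  \<open>Re f'\<close> is at once the starlikeness condition and the hypothesis of the univalence criterion.
\<close>

lemma log_integral_transform_starlike:
  assumes holo: "f holomorphic_on ball 0 1" and d0: "deriv f 0 = 1"
    and pos: "\<And>z. norm z < 1 \<Longrightarrow> 0 < Re (deriv f z)"
  shows "log_integral_transform f \<in> class_ST"
    and "\<And>z. norm z < 1 \<Longrightarrow> starlike_quotient (log_integral_transform f) z = deriv f z"
proof -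
  let ?g = "log_integral_transform f"
  obtain Q where Q: "Q holomorphic_on ball 0 1" and Q0: "Q 0 = 0"
    and g: "\<And>z. norm z < 1 \<Longrightarrow> ?g z = z * exp (Q z)"
    and dQ: "\<And>z. norm z < 1 \<Longrightarrow> z * deriv Q z = deriv f z - 1"
    using log_integral_transform_as_exp[OF holo d0] by blast
  have "(\<lambda>z. z * exp (Q z)) holomorphic_on ball 0 1"
    by (intro holomorphic_intros Q)
  then have g_holo: "?g holomorphic_on ball 0 1"
    by (rule holomorphic_transform) (simp add: g)
  have dg: "deriv ?g z = exp (Q z) * deriv f z" if "norm z < 1" for z
  proof (rule DERIV_imp_deriv)
    have z: "z \<in> ball 0 1"
      using that by simp
    have "((\<lambda>z. z * exp (Q z)) has_field_derivative exp (Q z) * (1 + z * deriv Q z)) (at z)"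
      using holomorphic_derivI[OF Q _ z]
      by (auto intro!: derivative_eq_intros simp: algebra_simps)
    then have "((\<lambda>z. z * exp (Q z)) has_field_derivative exp (Q z) * deriv f z) (at z)"
      using dQ[OF that] by simp
    then show "(?g has_field_derivative exp (Q z) * deriv f z) (at z)"
      by (rule has_field_derivative_transform_within_open[OF _ open_ball z]) (simp add: g)
  qed
  show quot: "starlike_quotient ?g z = deriv f z" if "norm z < 1" for z
    using that d0 by (simp add: starlike_quotient_def dg g)
  have "?g \<in> class_A"
    using g_holo dg[of 0] g[of 0] Q0 d0 by (intro class_A_I) auto
  moreover have "inj_on ?g (ball 0 1)"
  proof -
    have "inj_on (\<lambda>z. z * exp (Q z)) (ball 0 1)"
      using dQ pos by (intro inj_on_times_exp[OF Q]) simp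
    then show ?thesis
      using inj_on_cong[of "ball 0 1" ?g "\<lambda>z. z * exp (Q z)"] g by simp
  qed
  ultimately show "?g \<in> class_ST"
    using quot pos by (simp add: class_ST_def)
qed

theorem corollary3p8:
  fixes lam :: real and f :: "complex \<Rightarrow> complex"
  assumes "0 < lam" and "lam \<le> 1"
    and "f \<in> class_G lam"
  shows "\<exists>n::nat. n \<ge> 1 \<and>
           deriv f \<prec>\<^sub>s (\<lambda>z. (1 + z ^ n) powr of_real (lam / real n)) \<and>
           log_integral_transform f \<in> class_ST_ss (lam / real n)"
proof -
  have A: "f \<in> class_A" and nz: "\<And>z. norm z < 1 \<Longrightarrow> deriv f z \<noteq> 0"
    and Re: "\<And>z. norm z < 1 \<Longrightarrow> Re (z * deriv (deriv f) z / deriv f z) < lam / 2"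
    using assms(3) by (auto simp: class_G_def)
  have holo: "f holomorphic_on ball 0 1"
    using A by (simp add: class_A_def)
  have d0: "deriv f 0 = 1"
    using A by (rule class_A_deriv_0)
  have sub: "deriv f \<prec>\<^sub>s (\<lambda>z. (1 + z) powr of_real lam)"
    using assms(1) holo d0 nz Re
    by (intro subordinate_one_plus_powr holomorphic_deriv) auto
  have pos: "0 < Re (deriv f z)" if "norm z < 1" for z
  proof -
    obtain w where "w ` ball 0 1 \<subseteq> ball 0 1"
      and "\<forall>z\<in>ball 0 1. deriv f z = (1 + w z) powr of_real lam"
      using sub unfolding subordinate_def by blast
    then have "norm (w z) < 1" and "deriv f z = (1 + w z) powr of_real lam"
      using that by (simp_all add: image_subset_iff)
    then show ?thesis
      using Re_one_plus_powr_pos[OF assms(1,2)] by simp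
  qed
  note star = log_integral_transform_starlike[OF holo d0 pos]
  have "log_integral_transform f \<in> class_ST_ss lam"
    using star subordinate_cong_left[OF sub] by (simp add: class_ST_ss_def)
  with sub show ?thesis
    by (intro exI[of _ 1]) simp
qed

end
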